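(* For any positive integers $m$ and $n$, the total number $N(K_m\times P_n)$ of connected sets in $K_m\times P_n$ is $$N(K_m\times P_n)=\sum_{k=1}^{n}(n-k+1)\cdot(\mathbf{u}\cdot T^{k-1}\mathbf{1}),$$ where $\mathbf{u}=\begin{bmatrix}\binom{m}{1}&\binom{m}{2}&\cdots&\binom{m}{m}\end{bmatrix}$, $\mathbf{1}$ is the all-ones column vector of length $m$, and $T=(t_{ij})_{i,j\in\{1,\dots,m\}}$ is the $m\times m$ matrix with $$t_{ij}=\begin{cases}\binom{m}{j}-\binom{m-i}{j}, & \text{when } j\le m-i,\\ \binom{m}{j}, & \text{when } j\ge m-i+1.\end{cases}$$
   Context: All graphs are finite and simple. $K_m$ is the complete graph of order $m$ and $P_n$ is the path of order $n$. The Cartesian product $G\times H$ has vertex set $V(G)\times V(H)$ and edges all pairs $(u_1,v_1)(u_2,v_2)$ such that either $u_1u_2\in E(G)$ and $v_1=v_2$, or $v_1v_2\in E(H)$ and $u_1=u_2$. A connected set of a graph $G$ is a nonempty subset $C\subseteq V(G)$ such that the induced subgraph $G[C]$ is connected; $N(G)$ is the number of connected sets of $G$. *)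

theory Defs
  imports "Graph_Theory.Graph_Theory" "Jordan_Normal_Form.Matrix"
begin

text \<open>
  A finite simple graph is a \<^term>\<open>pair_graph\<close>: finitely many vertices, and a symmetric
  irreflexive set of ordered pairs, so that an edge \<open>uv\<close> is stored as both
  \<open>(u, v)\<close> and \<open>(v, u)\<close>.
\<close>

definition complete_graph :: "nat \<Rightarrow> nat pair_pre_digraph" where
  "complete_graph m = \<lparr> pverts = {1..m}, parcs = {(u, v). u \<in> {1..m} \<and> v \<in> {1..m} \<and> u \<noteq> v} \<rparr>"

definition path_graph :: "nat \<Rightarrow> nat pair_pre_digraph" where
  "path_graph n = \<lparr> pverts = {1..n},
     parcs = {(u, v). u \<in> {1..n} \<and> v \<in> {1..n} \<and> (v = u + 1 \<or> u = v + 1)} \<rparr>"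

definition cartesian_product ::
    "'a pair_pre_digraph \<Rightarrow> 'b pair_pre_digraph \<Rightarrow> ('a \<times> 'b) pair_pre_digraph" where
  "cartesian_product G H = \<lparr> pverts = pverts G \<times> pverts H,
     parcs = {((u1, v1), (u2, v2)).
        u1 \<in> pverts G \<and> u2 \<in> pverts G \<and> v1 \<in> pverts H \<and> v2 \<in> pverts H \<and>
        ((u1, u2) \<in> parcs G \<and> v1 = v2 \<or> (v1, v2) \<in> parcs H \<and> u1 = u2)} \<rparr>"

text \<open>The qualified name avoids the topological \<open>connected\<close>.\<close>

definition connected_sets :: "'a pair_pre_digraph \<Rightarrow> 'a set set" where
  "connected_sets G = {C. C \<noteq> {} \<and> C \<subseteq> pverts G \<and>
     Digraph_Component.connected (with_proj G \<restriction> C)}"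

definition num_connected_sets :: "'a pair_pre_digraph \<Rightarrow> nat" where
  "num_connected_sets G = card (connected_sets G)"

text \<open>
  Vectors and matrices are indexed from 0, so entry \<open>j\<close> of the mathematical vector
  (\<open>1 \<le> j \<le> m\<close>) sits at position \<open>j - 1\<close>.
\<close>

definition u_vec :: "nat \<Rightarrow> int vec" where
  "u_vec m = vec m (\<lambda>j. int (m choose (j + 1)))"

definition ones_vec :: "nat \<Rightarrow> int vec" where
  "ones_vec m = vec m (\<lambda>_. 1)"

definition t_entry :: "nat \<Rightarrow> nat \<Rightarrow> nat \<Rightarrow> int" where
  "t_entry m i j =
     (if j \<le> m - i then int (m choose j) - int ((m - i) choose j) else int (m choose j))"

definition T_mat :: "nat \<Rightarrow> int mat" where
  "T_mat m = mat m m (\<lambda>(i, j). t_entry m (i + 1) (j + 1))"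

lemma pair_graph_complete_graph: "pair_graph (complete_graph m)"
  by unfold_locales (auto simp: complete_graph_def symmetric_def sym_def
      intro: finite_subset[of _ "{1..m} \<times> {1..m}"])

lemma complete_digraph_complete_graph: "K\<^bsub>m\<^esub> (with_proj (complete_graph m))"
proof -
  interpret pair_graph "complete_graph m" by (rule pair_graph_complete_graph)
  show ?thesis
    unfolding complete_digraph_def using pair_graphD_graph
    by (auto simp: complete_graph_def)
qed

lemma pair_graph_path_graph: "pair_graph (path_graph n)"
  by unfold_locales (auto simp: path_graph_def symmetric_def sym_def
      intro: finite_subset[of _ "{1..n} \<times> {1..n}"])

lemma pair_graph_cartesian_product:
  assumes "pair_graph G" "pair_graph H"
  shows "pair_graph (cartesian_product G H)"
proof -
  interpret G: pair_graph G by fact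
  interpret H: pair_graph H by fact
  show ?thesis
  proof unfold_locales
    show "finite (pverts (cartesian_product G H))"
      by (simp add: cartesian_product_def G.pair_finite_verts H.pair_finite_verts)
    then show "finite (parcs (cartesian_product G H))"
      by (intro finite_subset[of "parcs (cartesian_product G H)"
            "pverts (cartesian_product G H) \<times> pverts (cartesian_product G H)"])
         (auto simp: cartesian_product_def)
  qed (auto simp: cartesian_product_def symmetric_def sym_def
        dest: G.arcs_symmetric H.arcs_symmetric G.no_loops' H.no_loops')
qed

end

theory Submission
  imports Defs
begin

text \<open>
  The layers of a connected set of \<open>K\<^sub>m \<times> P\<^sub>n\<close> occupy an interval of positions, and consecutive layers
  intersect, since the only edges between two layers are vertical. Conversely each layer spans a
  clique, so any sequence of \<open>k\<close> nonempty subsets of \<open>{1..m}\<close> with consecutive intersections gives a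
  connected set, in each of the \<open>n - k + 1\<close> positions of its bottom layer. The number of \<open>j\<close>-sets
  that meet a given \<open>i\<close>-set is \<open>t\<^sub>i\<^sub>j\<close>, hence \<open>T\<^sup>k\<^sup>-\<^sup>1 1\<close> counts the sequences by the size of their first
  set.
\<close>

section \<open>Chains of consecutively meeting sets, counted by the transfer matrix\<close>

definition meeting_chains :: "'a set \<Rightarrow> nat \<Rightarrow> 'a set list set" where
  "meeting_chains V k = {As. length As = k \<and> set As \<subseteq> Pow V - {{}} \<and>
     successively (\<lambda>A B. A \<inter> B \<noteq> {}) As}"

lemma finite_meeting_chains: "finite V \<Longrightarrow> finite (meeting_chains V k)"
  by (rule finite_subset[OF _ finite_lists_length_eq[of "Pow V" k]]) (auto simp: meeting_chains_def)

lemma meeting_chains_Suc_0_hd: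
  assumes "A \<in> Pow V - {{}}"
  shows "{As \<in> meeting_chains V (Suc 0). hd As = A} = {[A]}"
  using assms by (auto simp: meeting_chains_def length_Suc_conv)

text \<open>This is the recursion behind the transfer matrix: prepending \<open>A\<close> to a chain
  imposes a condition only on the head \<open>B\<close> of that chain. \<open>B\<close> need not be
  required nonempty, since meeting \<open>A\<close> forces it.\<close>

lemma meeting_chains_Suc_Suc_hd:
  assumes "A \<in> Pow V - {{}}"
  shows "{As \<in> meeting_chains V (Suc (Suc k)). hd As = A} =
    (#) A ` (\<Union>B \<in> {B. B \<subseteq> V \<and> A \<inter> B \<noteq> {}}. {As \<in> meeting_chains V (Suc k). hd As = B})"
proof (intro Set.set_eqI iffI)
  fix As assume "As \<in> {As \<in> meeting_chains V (Suc (Suc k)). hd As = A}"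
  then obtain B Bs where "As = A # B # Bs" "B \<subseteq> V" "A \<inter> B \<noteq> {}" "B # Bs \<in> meeting_chains V (Suc k)"
    by (auto simp: meeting_chains_def length_Suc_conv)
  then show "As \<in> (#) A ` (\<Union>B \<in> {B. B \<subseteq> V \<and> A \<inter> B \<noteq> {}}. {As \<in> meeting_chains V (Suc k). hd As = B})"
    by auto
next
  fix As assume "As \<in> (#) A ` (\<Union>B \<in> {B. B \<subseteq> V \<and> A \<inter> B \<noteq> {}}. {As \<in> meeting_chains V (Suc k). hd As = B})"
  then obtain Bs where "As = A # Bs" "A \<inter> hd Bs \<noteq> {}" "Bs \<in> meeting_chains V (Suc k)"
    by auto
  with assms show "As \<in> {As \<in> meeting_chains V (Suc (Suc k)). hd As = A}"
    by (auto simp: meeting_chains_def length_Suc_conv)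
qed

text \<open>Turns sums over sets into sums over sizes. Excluding the empty set makes the sizes run
  from 1 to \<open>card V\<close>; the shift to \<open>Suc j\<close> with \<open>j < card V\<close>
  fits the vectors, which are indexed from 0.\<close>

lemma sum_by_card:
  fixes g :: "nat \<Rightarrow> int"
  assumes V: "finite V" and F: "F \<subseteq> Pow V - {{}}"
  shows "(\<Sum>A\<in>F. g (card A)) = (\<Sum>j<card V. int (card {A \<in> F. card A = Suc j}) * g (Suc j))"
proof -
  have "finite F"
    using V F by (meson finite_Diff finite_Pow_iff finite_subset)
  have "card A \<in> {Suc 0..card V}" if "A \<in> F" for A
  proof -
    have "A \<subseteq> V" "A \<noteq> {}" using that F by auto
    with V show ?thesis by (auto simp: Suc_le_eq card_gt_0_iff card_mono finite_subset)
  qed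
  then have "card ` F \<subseteq> {Suc 0..card V}"
    by blast
  then have "(\<Sum>A\<in>F. g (card A)) = (\<Sum>j=Suc 0..card V. \<Sum>A\<in>{A \<in> F. card A = j}. g (card A))"
    using \<open>finite F\<close> by (intro sum.group[symmetric]) auto
  also have "\<dots> = (\<Sum>j=Suc 0..card V. int (card {A \<in> F. card A = j}) * g j)"
    by (intro sum.cong) auto
  finally show ?thesis
    by (simp only: sum.atLeast1_atMost_eq)
qed

text \<open>The \<open>j\<close>-subsets of \<open>V\<close> that miss \<open>A\<close> are the
  \<open>j\<close>-subsets of \<open>V - A\<close>; they are subtracted from all
  \<open>j\<close>-subsets.\<close>

lemma card_meeting_subsets:
  assumes V: "finite V" and A: "A \<subseteq> V"
  shows "int (card {B. B \<subseteq> V \<and> A \<inter> B \<noteq> {} \<and> card B = j}) = t_entry (card V) (card A) j"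
proof -
  have eq: "{B. B \<subseteq> V \<and> A \<inter> B \<noteq> {} \<and> card B = j} =
      {B. B \<subseteq> V \<and> card B = j} - {B. B \<subseteq> V - A \<and> card B = j}"
    by auto
  have sub: "{B. B \<subseteq> V - A \<and> card B = j} \<subseteq> {B. B \<subseteq> V \<and> card B = j}"
    by auto
  have "int (card {B. B \<subseteq> V \<and> A \<inter> B \<noteq> {} \<and> card B = j}) =
      int (card {B. B \<subseteq> V \<and> card B = j}) - int (card {B. B \<subseteq> V - A \<and> card B = j})"
    unfolding eq using sub V
    by (subst card_Diff_subset) (auto intro!: of_nat_diff card_mono intro: finite_subset)
  also have "\<dots> = int (card V choose j) - int ((card V - card A) choose j)"
    using V A by (simp add: n_subsets card_Diff_subset finite_subset)
  \<comment> \<open>When \<open>j\<close> exceeds \<open>card V - card A\<close>, the subtracted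
    binomial is zero, so both branches of \<open>t_entry\<close> agree with the difference.\<close>
  also have "\<dots> = t_entry (card V) (card A) j"
    by (auto simp: t_entry_def)
  finally show ?thesis .
qed

text \<open>\<open>pow_mat\<close> adds each new factor on the right, whereas prepending a set to a
  chain calls for the new factor on the left. Powers of \<open>M\<close> commute with
  \<open>M\<close>, which is shown here by induction for all \<open>v\<close>.\<close>

lemma pow_mat_Suc_mult_vec:
  fixes M :: "'a :: comm_semiring_1 mat"
  assumes "M \<in> carrier_mat m m" "v \<in> carrier_vec m"
  shows "M ^\<^sub>m Suc k *\<^sub>v v = M *\<^sub>v (M ^\<^sub>m k *\<^sub>v v)"
  using assms(2)
proof (induction k arbitrary: v)
  case 0
  then show ?case using assms(1) by auto
next
  case (Suc k)
  have shift: "M ^\<^sub>m Suc l *\<^sub>v v = M ^\<^sub>m l *\<^sub>v (M *\<^sub>v v)" for l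
    unfolding pow_mat.simps using assms(1) Suc.prems by (intro assoc_mult_mat_vec) auto
  have "M ^\<^sub>m Suc (Suc k) *\<^sub>v v = M ^\<^sub>m Suc k *\<^sub>v (M *\<^sub>v v)"
    by (rule shift)
  also have "\<dots> = M *\<^sub>v (M ^\<^sub>m k *\<^sub>v (M *\<^sub>v v))"
    using assms(1) Suc.prems by (intro Suc.IH) simp
  also have "M ^\<^sub>m k *\<^sub>v (M *\<^sub>v v) = M ^\<^sub>m Suc k *\<^sub>v v"
    by (rule shift[symmetric])
  finally show ?case .
qed

text \<open>By induction the number of continuations depends on the second set only through its
  size. Grouping the possible second sets by size therefore yields the row of \<open>T_mat\<close>
  for \<open>card A\<close>, applied to the vector of the shorter chains. A set of size
  \<open>i\<close> corresponds to position \<open>i - 1\<close>.\<close>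

lemma card_meeting_chains_hd:
  assumes V: "finite V" and A: "A \<in> Pow V - {{}}"
  shows "int (card {As \<in> meeting_chains V (Suc k). hd As = A}) =
    (T_mat (card V) ^\<^sub>m k *\<^sub>v ones_vec (card V)) $ (card A - 1)"
  using A
proof (induction k arbitrary: A)
  case 0
  then have "card A - 1 < card V"
    using V by (metis Diff_iff PowD Suc_pred' card_gt_0_iff card_mono finite_subset insertCI
        less_eq_Suc_le One_nat_def)
  then show ?case
    using 0 by (simp add: meeting_chains_Suc_0_hd T_mat_def ones_vec_def)
next
  case (Suc k)
  define m where "m = card V"
  define w where "w = T_mat m ^\<^sub>m k *\<^sub>v ones_vec m"
  have T: "T_mat m \<in> carrier_mat m m" and one: "ones_vec m \<in> carrier_vec m"
    by (auto simp: T_mat_def ones_vec_def)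
  have dim: "dim_vec w = m"
    using T by (simp add: w_def)
  have "card A \<le> m" "card A > 0"
    using Suc.prems V by (auto simp: m_def card_mono card_gt_0_iff intro: finite_subset)
  define F where "F = {B. B \<subseteq> V \<and> A \<inter> B \<noteq> {}}"
  have "finite F" and F: "F \<subseteq> Pow V - {{}}"
    using V by (auto simp: F_def)
  have "int (card {As \<in> meeting_chains V (Suc (Suc k)). hd As = A}) =
      int (card (\<Union>B\<in>F. {As \<in> meeting_chains V (Suc k). hd As = B}))"
    unfolding meeting_chains_Suc_Suc_hd[OF Suc.prems] F_def by (subst card_image) auto
  also have "\<dots> = (\<Sum>B\<in>F. int (card {As \<in> meeting_chains V (Suc k). hd As = B}))"
    using \<open>finite F\<close> finite_meeting_chains[OF V] by (subst card_UN_disjoint) auto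
  also have "\<dots> = (\<Sum>B\<in>F. w $ (card B - 1))"
    using F Suc.IH by (intro sum.cong) (auto simp: w_def m_def)
  \<comment> \<open>The sum is regrouped by size with the weight \<open>w $ (j - 1)\<close>, which
    at size \<open>Suc j\<close> becomes \<open>w $ j\<close>.\<close>
  also have "\<dots> = (\<Sum>j<m. int (card {B \<in> F. card B = Suc j}) * w $ j)"
    using sum_by_card[OF V F, of "\<lambda>j. w $ (j - 1)"] by (simp add: m_def)
  also have "\<dots> = (\<Sum>j<m. t_entry m (card A) (Suc j) * w $ j)"
    using card_meeting_subsets[OF V, of A] Suc.prems by (simp add: F_def m_def)
  also have "\<dots> = (T_mat m *\<^sub>v w) $ (card A - 1)"
    using \<open>card A \<le> m\<close> \<open>card A > 0\<close> dim
    by (auto simp: T_mat_def scalar_prod_def atLeast0LessThan intro!: sum.cong)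
  also have "T_mat m *\<^sub>v w = T_mat m ^\<^sub>m Suc k *\<^sub>v ones_vec m"
    using pow_mat_Suc_mult_vec[OF T one] by (simp add: w_def)
  finally show ?case
    by (simp add: m_def)
qed

text \<open>The first set is now free: \<open>u_vec\<close> counts the nonempty subsets by size, and
  each is weighted by the number of chains that start with it.\<close>

lemma card_meeting_chains:
  assumes V: "finite V"
  shows "int (card (meeting_chains V (Suc k))) =
    u_vec (card V) \<bullet> (T_mat (card V) ^\<^sub>m k *\<^sub>v ones_vec (card V))"
proof -
  define m where "m = card V"
  define w where "w = T_mat m ^\<^sub>m k *\<^sub>v ones_vec m"
  have "T_mat m \<in> carrier_mat m m"
    by (auto simp: T_mat_def)
  then have dim: "dim_vec w = m"
    by (simp add: w_def)
  define F where "F = Pow V - {{}}"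
  have "finite F" and F: "F \<subseteq> Pow V - {{}}"
    using V by (auto simp: F_def)
  have count: "card {B \<in> F. card B = Suc j} = m choose Suc j" for j
  proof -
    have "{B \<in> F. card B = Suc j} = {B. B \<subseteq> V \<and> card B = Suc j}"
      by (auto simp: F_def)
    then show ?thesis using V by (simp add: n_subsets m_def)
  qed
  have "meeting_chains V (Suc k) = (\<Union>A\<in>F. {As \<in> meeting_chains V (Suc k). hd As = A})"
    by (auto simp: meeting_chains_def F_def length_Suc_conv)
  then have "int (card (meeting_chains V (Suc k))) =
      int (card (\<Union>A\<in>F. {As \<in> meeting_chains V (Suc k). hd As = A}))"
    by simp
  also have "\<dots> = (\<Sum>A\<in>F. int (card {As \<in> meeting_chains V (Suc k). hd As = A}))"
    using \<open>finite F\<close> finite_meeting_chains[OF V] by (subst card_UN_disjoint) auto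
  also have "\<dots> = (\<Sum>A\<in>F. w $ (card A - 1))"
    unfolding w_def m_def using F by (intro sum.cong refl card_meeting_chains_hd[OF V]) auto
  also have "\<dots> = (\<Sum>j<m. int (m choose Suc j) * w $ j)"
    using sum_by_card[OF V F, of "\<lambda>j. w $ (j - 1)"] count by (simp add: m_def)
  also have "\<dots> = u_vec m \<bullet> w"
    using dim by (auto simp: u_vec_def scalar_prod_def atLeast0LessThan intro!: sum.cong)
  finally show ?thesis
    by (simp add: w_def m_def)
qed

section \<open>Connectedness as reachability inside a vertex set\<close>

lemma rtrancl_on_Restr: "rtrancl_on F (r \<inter> F \<times> F) = rtrancl_on F r"
proof (intro Set.set_eqI iffI; clarify)
  fix x y assume "(x, y) \<in> rtrancl_on F r"
  then show "(x, y) \<in> rtrancl_on F (r \<inter> F \<times> F)"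
    by induct (auto intro: converse_rtrancl_on_into_rtrancl_on)
next
  fix x y assume "(x, y) \<in> rtrancl_on F (r \<inter> F \<times> F)"
  then show "(x, y) \<in> rtrancl_on F r"
    by (rule rtrancl_on_mono[rotated 2]) auto
qed

text \<open>The arcs of a \<open>pair_graph\<close> are already symmetric, so the symmetric closure
  in the definition of connectedness adds nothing, and the induced subgraph keeps exactly the arcs
  inside \<open>C\<close>.\<close>

lemma connected_sets_iff:
  assumes "pair_graph G"
  shows "C \<in> connected_sets G \<longleftrightarrow>
    C \<noteq> {} \<and> C \<subseteq> pverts G \<and> (\<forall>x\<in>C. \<forall>y\<in>C. (x, y) \<in> rtrancl_on C (parcs G))"
proof -
  interpret pair_graph G by fact
  have "(arcs_ends (with_proj G \<restriction> C))\<^sup>s = parcs G \<inter> C \<times> C"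
    by (auto simp: symcl_def arcs_ends_conv image_iff dest: arcs_symmetric)
  then show ?thesis
    by (auto simp: connected_sets_def connected_conv rtrancl_on_Restr)
qed

text \<open>Some step of a walk must be the one that leaves \<open>P\<close>. Below,
  \<open>P\<close> says that a vertex lies at or below a given height.\<close>

lemma rtrancl_on_crossing:
  assumes "(x, y) \<in> rtrancl_on F r" "P x" "\<not> P y"
  obtains p q where "(p, q) \<in> r" "p \<in> F" "q \<in> F" "P p" "\<not> P q"
  using assms by (induct rule: rtrancl_on_induct) auto

section \<open>Vertex sets assembled from a bottom height and a list of layers\<close>

definition stack :: "nat \<Rightarrow> 'a set list \<Rightarrow> ('a \<times> nat) set" where
  "stack a As = {(u, v). \<exists>i<length As. v = a + i \<and> u \<in> As ! i}"

lemma nth_eq_stack: "i < length As \<Longrightarrow> As ! i = {u. (u, a + i) \<in> stack a As}"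
  by (auto simp: stack_def)

lemma snd_stack:
  assumes "{} \<notin> set As"
  shows "snd ` stack a As = {a..<a + length As}"
proof
  show "{a..<a + length As} \<subseteq> snd ` stack a As"
  proof
    fix v assume "v \<in> {a..<a + length As}"
    then have i: "v - a < length As" "v = a + (v - a)" by auto
    then have "As ! (v - a) \<noteq> {}" using assms by (metis nth_mem)
    then obtain u where "u \<in> As ! (v - a)" by auto
    with i have "(u, v) \<in> stack a As" by (auto simp: stack_def)
    then show "v \<in> snd ` stack a As" by force
  qed
qed (auto simp: stack_def)

text \<open>The set of occupied heights is an interval that reveals the bottom and the number of
  layers, after which each layer can be read off. A stack without layers would leave
  \<open>a\<close> undetermined.\<close>

lemma stack_inject:
  assumes "stack a As = stack b Bs" "{} \<notin> set As" "{} \<notin> set Bs" "As \<noteq> []"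
  shows "a = b \<and> As = Bs"
proof -
  have "{a..<a + length As} = {b..<b + length Bs}"
    using snd_stack assms by metis
  moreover have "0 < length As" using assms(4) by simp
  ultimately have ab: "a = b" and len: "length As = length Bs"
    by (auto simp: Ico_eq_Ico)
  have "As ! i = Bs ! i" if "i < length As" for i
    using nth_eq_stack[of i As a] nth_eq_stack[of i Bs a] that len ab assms(1) by simp
  with ab len show ?thesis by (simp add: nth_equalityI)
qed

section \<open>Connected sets of the product are exactly the stacks of chains\<close>

lemma pverts_grid: "pverts (cartesian_product (complete_graph m) (path_graph n)) = {1..m} \<times> {1..n}"
  by (simp add: cartesian_product_def complete_graph_def path_graph_def)

lemma parcs_grid:
  "((u, v), (u', v')) \<in> parcs (cartesian_product (complete_graph m) (path_graph n)) \<longleftrightarrow>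
    (u, v) \<in> {1..m} \<times> {1..n} \<and> (u', v') \<in> {1..m} \<times> {1..n} \<and>
    (u \<noteq> u' \<and> v = v' \<or> u = u' \<and> (v' = v + 1 \<or> v = v' + 1))"
  by (auto simp: cartesian_product_def complete_graph_def path_graph_def)

lemma pair_graph_grid: "pair_graph (cartesian_product (complete_graph m) (path_graph n))"
  by (intro pair_graph_cartesian_product pair_graph_complete_graph pair_graph_path_graph)

text \<open>All vertices are reached from one vertex \<open>(u0, a)\<close> of the bottom layer by
  climbing through common columns of consecutive layers; symmetry of the arcs then joins any two
  vertices.\<close>

lemma stack_connected:
  assumes As: "As \<in> meeting_chains {1..m} k" and "k \<ge> 1" "a \<ge> 1" "a + k \<le> n + 1"
  shows "stack a As \<in> connected_sets (cartesian_product (complete_graph m) (path_graph n))"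
proof -
  define R where "R = parcs (cartesian_product (complete_graph m) (path_graph n))"
  define C where "C = stack a As"
  interpret pair_graph "cartesian_product (complete_graph m) (path_graph n)"
    by (rule pair_graph_grid)
  have sub: "As ! i \<subseteq> {1..m}" and ne: "As ! i \<noteq> {}" if "i < k" for i
    using As that by (auto simp: meeting_chains_def dest!: nth_mem)
  have inter: "As ! i \<inter> As ! Suc i \<noteq> {}" if "Suc i < k" for i
    using As that by (auto simp: meeting_chains_def successively_conv_nth)
  have len: "length As = k" using As by (auto simp: meeting_chains_def)
  have C_verts: "C \<subseteq> {1..m} \<times> {1..n}"
    using sub assms len by (fastforce simp: C_def stack_def)
  have same: "((u, v), (u', v)) \<in> rtrancl_on C R" if "(u, v) \<in> C" "(u', v) \<in> C" for u u' v
  proof (cases "u = u'")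
    case False
    with that C_verts have "((u, v), (u', v)) \<in> R" by (auto simp: R_def parcs_grid)
    with that show ?thesis by (auto intro: rtrancl_on_into_rtrancl_on)
  qed (use that in auto)
  obtain u0 where "u0 \<in> As ! 0" using ne[of 0] assms(2) by auto
  then have x0: "(u0, a) \<in> C" using assms(2) len by (auto simp: C_def stack_def)
  have from_bottom: "((u0, a), (u, a + i)) \<in> rtrancl_on C R" if "i < k" "u \<in> As ! i" for i u
    using that
  proof (induction i arbitrary: u)
    case 0
    then have "(u, a) \<in> C" by (auto simp: C_def stack_def len)
    with x0 show ?case by (simp add: same)
  next
    case (Suc i)
    \<comment> \<open>\<open>w\<close> is a column shared by both layers: go to it in layer
      \<open>i\<close>, step up vertically, then move sideways to \<open>u\<close> within the
      clique.\<close>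
    from inter[OF Suc.prems(1)] obtain w where w: "w \<in> As ! i" "w \<in> As ! Suc i" by auto
    have "((u0, a), (w, a + i)) \<in> rtrancl_on C R"
      using Suc w by simp
    moreover have wC: "(w, a + i) \<in> C" "(w, a + Suc i) \<in> C" "(u, a + Suc i) \<in> C"
      using Suc.prems w by (auto simp: C_def stack_def len)
    then have "((w, a + i), (w, a + Suc i)) \<in> R"
      using C_verts by (auto simp: R_def parcs_grid)
    ultimately have "((u0, a), (w, a + Suc i)) \<in> rtrancl_on C R"
      using wC by (blast intro: rtrancl_on_into_rtrancl_on)
    then show ?case using same wC by (blast intro: rtrancl_on_trans)
  qed
  have from_x0: "((u0, a), x) \<in> rtrancl_on C R" if "x \<in> C" for x
    using that from_bottom by (auto simp: C_def stack_def len)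
  have "sym R"
    unfolding R_def by (auto simp: sym_def dest: arcs_symmetric)
  then have "sym (rtrancl_on C R)" by (rule rtrancl_on_sym)
  then have "(x, y) \<in> rtrancl_on C R" if "x \<in> C" "y \<in> C" for x y
    using from_x0 that by (meson rtrancl_on_trans symD)
  with x0 C_verts show ?thesis
    unfolding connected_sets_iff[OF pair_graph_grid] pverts_grid R_def C_def by blast
qed

text \<open>A walk from the lowest to the highest vertex crosses every gap between consecutive
  heights, and only a vertical edge can do so. Hence no layer in between is empty and neighbouring
  layers share a column.\<close>

lemma connected_set_is_stack:
  assumes "C \<in> connected_sets (cartesian_product (complete_graph m) (path_graph n))"
  obtains k a As where "k \<ge> 1" "a \<ge> 1" "a + k \<le> n + 1" "As \<in> meeting_chains {1..m} k" "C = stack a As"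
proof -
  define R where "R = parcs (cartesian_product (complete_graph m) (path_graph n))"
  have "C \<noteq> {}" and C_verts: "C \<subseteq> {1..m} \<times> {1..n}"
    and reach: "\<And>x y. x \<in> C \<Longrightarrow> y \<in> C \<Longrightarrow> (x, y) \<in> rtrancl_on C R"
    using assms unfolding connected_sets_iff[OF pair_graph_grid] pverts_grid R_def by blast+
  have fin: "finite (snd ` C)" "snd ` C \<noteq> {}"
    using finite_subset[OF C_verts] \<open>C \<noteq> {}\<close> by auto
  define a b where "a = Min (snd ` C)" and "b = Max (snd ` C)"
  have "a \<in> snd ` C" "b \<in> snd ` C"
    using fin by (simp_all add: a_def b_def)
  then obtain x y where x: "x \<in> C" "snd x = a" and y: "y \<in> C" "snd y = b" by auto
  have range: "a \<le> v" "v \<le> b" if "(u, v) \<in> C" for u v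
    using that fin by (force simp: a_def b_def intro: Min_le Max_ge)+
  have ab: "a \<le> b" "1 \<le> a" "b \<le> n"
    using x y range[of "fst x" "snd x"] C_verts by auto
  define k where "k = b + 1 - a"
  define As where "As = map (\<lambda>i. {u. (u, a + i) \<in> C}) [0..<k]"
  have meet: "\<exists>u. (u, v) \<in> C \<and> (u, Suc v) \<in> C" if "a \<le> v" "v < b" for v
  proof -
    have "snd x \<le> v" "\<not> snd y \<le> v"
      using x y that by auto
    with reach[OF x(1) y(1)]
    obtain p q where "(p, q) \<in> R" "p \<in> C" "q \<in> C" "snd p \<le> v" "\<not> snd q \<le> v"
      by (rule rtrancl_on_crossing[where P = "\<lambda>z. snd z \<le> v"])
    \<comment> \<open>An edge that changes height does so by exactly one and keeps the
      column.\<close>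
    then have "snd p = v" "snd q = Suc v" "fst p = fst q"
      by (cases p; cases q; auto simp: R_def parcs_grid)+
    with \<open>p \<in> C\<close> \<open>q \<in> C\<close> show ?thesis by (metis prod.collapse)
  qed
  have "{u. (u, a + i) \<in> C} \<noteq> {}" if "i < k" for i
  \<comment> \<open>A layer below the top is nonempty by \<open>meet\<close>; the top layer has no
    gap above it and contains \<open>y\<close> instead.\<close>
  proof (cases "a + i < b")
    case True
    then show ?thesis using meet[of "a + i"] by auto
  next
    case False
    with that have "a + i = b" by (simp add: k_def)
    then show ?thesis using y by (metis (mono_tags) empty_iff mem_Collect_eq prod.collapse)
  qed
  then have "{} \<notin> set As"
    unfolding As_def set_map set_upt image_iff by (metis atLeastLessThan_iff)
  moreover have "successively (\<lambda>A B. A \<inter> B \<noteq> {}) As"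
    unfolding successively_conv_nth
    using meet ab by (auto simp: As_def k_def set_eq_iff)
  moreover have "length As = k" "set As \<subseteq> Pow {1..m}"
    using C_verts by (auto simp: As_def)
  ultimately have "As \<in> meeting_chains {1..m} k"
    by (auto simp: meeting_chains_def)
  moreover have "C = stack a As"
  proof (intro Set.set_eqI iffI; clarify)
    fix u v assume "(u, v) \<in> C"
    with range[OF this] show "(u, v) \<in> stack a As"
      by (auto simp: stack_def As_def k_def intro!: exI[of _ "v - a"])
  qed (auto simp: stack_def As_def)
  ultimately show ?thesis
    using that[of k a As] ab by (simp add: k_def)
qed

theorem theorem1p2:
  fixes m n :: nat
  assumes "m \<ge> 1" and "n \<ge> 1"
  shows "int (num_connected_sets (cartesian_product (complete_graph m) (path_graph n))) =
    (\<Sum>k = 1..n. int (n - k + 1) * (u_vec m \<bullet> (T_mat m ^\<^sub>m (k - 1) *\<^sub>v ones_vec m)))"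
proof -
  \<comment> \<open>For \<open>k \<le> n\<close> the bottom heights with
    \<open>a + k \<le> n + 1\<close> are \<open>1..n - k + 1\<close>, which gives the factor in the
    sum.\<close>
  define S where "S = (SIGMA k:{1..n}. {1..n - k + 1} \<times> meeting_chains {1..m} k)"
  have "bij_betw (\<lambda>(k, a, As). stack a As) S
      (connected_sets (cartesian_product (complete_graph m) (path_graph n)))"
  proof (rule bij_betwI')
    fix p q assume "p \<in> S" "q \<in> S"
    then obtain k a As l b Bs where p: "p = (k, a, As)" and q: "q = (l, b, Bs)"
      and "As \<in> meeting_chains {1..m} k" "Bs \<in> meeting_chains {1..m} l" "k \<ge> 1"
      by (auto simp: S_def)
    then have "length As = k" "length Bs = l" "{} \<notin> set As" "{} \<notin> set Bs" "As \<noteq> []"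
      by (auto simp: meeting_chains_def)
    \<comment> \<open>Equal stacks have the same list of layers, and \<open>k\<close> and
      \<open>l\<close> are the lengths of these lists.\<close>
    then show "((case p of (k, a, As) \<Rightarrow> stack a As) = (case q of (k, a, As) \<Rightarrow> stack a As)) = (p = q)"
      using stack_inject[of a As b Bs] p q by auto
  next
    fix p assume "p \<in> S"
    then show "(case p of (k, a, As) \<Rightarrow> stack a As) \<in>
        connected_sets (cartesian_product (complete_graph m) (path_graph n))"
      by (auto simp: S_def intro!: stack_connected)
  next
    fix C assume "C \<in> connected_sets (cartesian_product (complete_graph m) (path_graph n))"
    then obtain k a As where "k \<ge> 1" "a \<ge> 1" "a + k \<le> n + 1" "As \<in> meeting_chains {1..m} k"
      and C: "C = stack a As"
      by (rule connected_set_is_stack)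
    then have "(k, a, As) \<in> S"
      by (auto simp: S_def)
    with C show "\<exists>p\<in>S. C = (case p of (k, a, As) \<Rightarrow> stack a As)"
      by (intro bexI[of _ "(k, a, As)"]) auto
  qed
  then have "num_connected_sets (cartesian_product (complete_graph m) (path_graph n)) = card S"
    unfolding num_connected_sets_def by (metis bij_betw_same_card)
  also have "card S = (\<Sum>k=1..n. (n - k + 1) * card (meeting_chains {1..m} k))"
    unfolding S_def by (simp add: finite_meeting_chains card_cartesian_product)
  also have "int \<dots> = (\<Sum>k=1..n. int (n - k + 1) * int (card (meeting_chains {1..m} k)))"
    by (simp only: of_nat_sum of_nat_mult)
  also have "\<dots> =
      (\<Sum>k = 1..n. int (n - k + 1) * (u_vec m \<bullet> (T_mat m ^\<^sub>m (k - 1) *\<^sub>v ones_vec m)))"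
  proof (intro sum.cong refl arg_cong2[where f = "(*)"])
    fix k assume "k \<in> {1..n}"
    then show "int (card (meeting_chains {1..m} k)) =
        u_vec m \<bullet> (T_mat m ^\<^sub>m (k - 1) *\<^sub>v ones_vec m)"
      using card_meeting_chains[of "{1..m}" "k - 1"] by simp
  qed
  finally show ?thesis .
qed

end
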